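(* For every $d\ge 1$, the group $\mathbb{Z}^d$ is algebraically recurrent. More generally, if $(H_n)_{n\ge1}$ is a non-degenerate, Liouville, symmetric, decreasing sequence of random subsemigroups of $\mathbb{Z}^d$, then almost surely $H_n=\mathbb{Z}^d$ for all $n$.
   Context: For a countable group $G$ and a probability measure $\mu$ on $G$, a $\mu$-random walk is $X_n=\zeta_1\cdots\zeta_n$ with $\zeta_i$ i.i.d. of law $\mu$; $\mathcal{S}_n$ denotes the semigroup generated by $\{X_n,X_{n+1},\ldots\}$. $(G,\mu)$ is algebraically recurrent (AR) if for every $n$, $\mathcal{S}_n=G$ almost surely; $G$ is AR if $(G,\mu)$ is AR for every symmetric probability measure $\mu$ (i.e. $\mu(g)=\mu(g^{-1})$) whose support generates $G$ as a group. Let $\mathfrak{S}(G)$ be the set of subsemigroups of $G$, viewed as a subset of $\{0,1\}^G$ with the product topology (a compact standard Borel space). A decreasing sequence $(H_n)$ of $\mathfrak{S}(G)$-valued random variables ($H_{n+1}\subseteq H_n$) is: non-degenerate if almost surely $H_n$ generates $G$ as a group for all $n$; Liouville if its tail $\sigma$-algebra $\bigcap_n\sigma(H_n,H_{n+1},\ldots)$ is trivial; symmetric if for every $n$, $H_n$ and $H_n^{-1}=\{h^{-1}:h\in H_n\}$ have the same distribution on $\mathfrak{S}(G)$. *)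

theory Defs
  imports "HOL-Probability.Probability"
begin

text \<open>Groups are written additively (the groups in question are abelian,
here the type of integer vectors \<open>int ^ 'n\<close>, i.e. Z^d with d = CARD('n)).\<close>

inductive_set group_gen :: "'a::ab_group_add set \<Rightarrow> 'a set" for S where
  gg_base: "x \<in> S \<Longrightarrow> x \<in> group_gen S"
| gg_zero: "0 \<in> group_gen S"
| gg_add: "x \<in> group_gen S \<Longrightarrow> y \<in> group_gen S \<Longrightarrow> x + y \<in> group_gen S"
| gg_neg: "x \<in> group_gen S \<Longrightarrow> - x \<in> group_gen S"

inductive_set semigroup_gen :: "'a::plus set \<Rightarrow> 'a set" for S where
  sg_base: "x \<in> S \<Longrightarrow> x \<in> semigroup_gen S"
| sg_add: "x \<in> semigroup_gen S \<Longrightarrow> y \<in> semigroup_gen S \<Longrightarrow> x + y \<in> semigroup_gen S"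

definition subsemigroup :: "'a::plus set \<Rightarrow> bool" where
  "subsemigroup S \<longleftrightarrow> (\<forall>x\<in>S. \<forall>y\<in>S. x + y \<in> S)"

definition symmetric_pmf :: "'a::group_add pmf \<Rightarrow> bool" where
  "symmetric_pmf \<mu> \<longleftrightarrow> (\<forall>g. pmf \<mu> g = pmf \<mu> (- g))"

text \<open>Position of the random walk X_n = zeta_1 + ... + zeta_n, for a sample
  path \<open>\<omega>\<close> of increments (canonical product space, increments \<open>\<omega> i\<close>, i \<ge> 1).\<close>
definition rw_pos :: "(nat \<Rightarrow> 'a::comm_monoid_add) \<Rightarrow> nat \<Rightarrow> 'a" where
  "rw_pos \<omega> n = (\<Sum>i\<in>{1..n}. \<omega> i)"

definition algebraically_recurrent :: "'a::ab_group_add pmf \<Rightarrow> bool" where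
  "algebraically_recurrent \<mu> \<longleftrightarrow>
     (\<forall>n\<ge>1. AE \<omega> in (\<Pi>\<^sub>M i\<in>(UNIV::nat set). measure_pmf \<mu>).
        semigroup_gen {rw_pos \<omega> m | m. m \<ge> n} = UNIV)"

text \<open>Measurable space on subsets of G: the product sigma-algebra of {0,1}^G,
  generated by the coordinate events {A. g \<in> A}.\<close>
definition subsets_measure :: "'a set measure" where
  "subsets_measure = sigma UNIV {{A. g \<in> A} | g. True}"

end

theory Submission
  imports Defs "HOL-Analysis.Kronecker_Approximation_Theorem"
begin

text \<open>
  Let \<open>P\<^sub>n\<close> be the cone of all real vectors \<open>v\<close> with \<open>v \<bullet> h \<ge> 0\<close> for every \<open>h\<close> in \<open>H\<^sub>n\<close>. These cones
  increase with \<open>n\<close>, and whether their union \<open>P\<close> meets a given compact set is a tail event. By the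
  0-1 law and the symmetry of \<open>H\<^sub>n\<close>, almost surely \<open>P\<close> meets a small ball if and only if it meets
  the opposite ball, so the closure of \<open>P\<close> is a linear subspace. A convex set contains the relative
  interior of its closure, hence \<open>P\<close> is this subspace. If \<open>v\<close> and \<open>- v\<close> both lie in \<open>P\<close>, then
  some \<open>H\<^sub>n\<close> is orthogonal to \<open>v\<close>, and \<open>v = 0\<close> since \<open>H\<^sub>n\<close> generates the group. Thus no \<open>H\<^sub>n\<close> lies
  in a half-space, and a generating subsemigroup of the integer lattice with this property is everything.

  For the random walk, the events in question are invariant under finite permutations of the
  increments, so the 0-1 law is that of Hewitt and Savage.
\<close>

subsection \<open>Subsemigroups of the integer lattice and half-spaces\<close>

definition real_vec :: "int ^ 'd \<Rightarrow> real ^ 'd" where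
  "real_vec x = (\<chi> i. real_of_int (x $ i))"

lemma real_vec_nth [simp]: "real_vec x $ i = real_of_int (x $ i)"
  by (simp add: real_vec_def)

lemma real_vec_uminus: "real_vec (- x) = - real_vec x"
  by (simp add: vec_eq_iff)

definition dual_cone :: "(int ^ 'd) set \<Rightarrow> (real ^ 'd) set" where
  "dual_cone A = {v. \<forall>h\<in>A. 0 \<le> v \<bullet> real_vec h}"

lemma dual_cone_antimono: "A \<subseteq> B \<Longrightarrow> dual_cone B \<subseteq> dual_cone A"
  by (auto simp: dual_cone_def)

lemma dual_cone_uminus_image: "v \<in> dual_cone (uminus ` A) \<longleftrightarrow> - v \<in> dual_cone A"
  by (auto simp: dual_cone_def real_vec_uminus)

lemma convex_cone_dual_cone: "convex_cone (dual_cone A)"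
  by (auto simp: convex_cone_iff dual_cone_def inner_add_left)

text \<open>A simultaneous Diophantine approximation of the real coefficients gives integer coefficients
  whose combination is an integer vector with all entries smaller than 1.\<close>

lemma positive_integer_relation:
  fixes F :: "(int ^ 'd) set" and c :: "int ^ 'd \<Rightarrow> real"
  assumes fin: "finite F" and pos: "\<And>x. x \<in> F \<Longrightarrow> 0 < c x"
    and rel: "(\<Sum>x\<in>F. c x *\<^sub>R real_vec x) = 0"
  obtains p :: "int ^ 'd \<Rightarrow> int" where "\<And>x. x \<in> F \<Longrightarrow> 0 < p x" "(\<Sum>x\<in>F. p x *s x) = 0"
proof -
  obtain f where f: "bij_betw f {0..<card F} F"
    using ex_bij_betw_nat_finite[OF fin] by blast
  \<comment> \<open>The inserted 1 keeps the minimum meaningful for empty \<open>F\<close>.\<close>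
  define m where "m = Min (insert 1 (c ` F))"
  have m: "0 < m" "\<And>x. x \<in> F \<Longrightarrow> m \<le> c x"
    using fin pos by (auto simp: m_def)
  define B where "B = 1 + (\<Sum>x\<in>F. \<Sum>i\<in>UNIV. \<bar>real_of_int (x $ i)\<bar>)"
  have B: "1 \<le> B" by (simp add: B_def sum_nonneg)
  \<comment> \<open>\<open>N > 1 / m\<close> makes the rounded coefficients positive, and
    \<open>N > B\<close> keeps the total rounding error of each entry below 1.\<close>
  obtain N :: nat where N: "max (1 / m) B < real N"
    using reals_Archimedean2 by blast
  have N0: "0 < N" using N B by (cases N) auto
  have Nm: "1 / real N < m" using N m(1) N0 by (simp add: field_simps)
  obtain q r where q: "0 < q" and r: "\<And>i. i < card F \<Longrightarrow> \<bar>of_int q * c (f i) - of_int (r i)\<bar> < 1 / real N"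
    using Dirichlet_approx_simult[OF N0, of "card F" "\<lambda>i. c (f i)"] by metis
  define p where "p x = r (inv_into {0..<card F} f x)" for x
  have p: "\<bar>of_int q * c x - of_int (p x)\<bar> < 1 / real N" if "x \<in> F" for x
  proof -
    have "inv_into {0..<card F} f x \<in> {0..<card F}"
      using f that by (metis bij_betw_imp_surj_on inv_into_into)
    moreover have "f (inv_into {0..<card F} f x) = x"
      using f that by (metis bij_betw_inv_into_right)
    ultimately show ?thesis
      using r[of "inv_into {0..<card F} f x"] by (simp add: p_def)
  qed
  have "0 < p x" if "x \<in> F" for x
  proof -
    have "1 * c x \<le> of_int q * c x"
      using q pos[OF that] by (intro mult_right_mono) auto
    then have "0 < real_of_int (p x)"
      using p[OF that] m(2)[OF that] Nm by linarith
    then show ?thesis by simp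
  qed
  moreover have "(\<Sum>x\<in>F. p x *s x) $ i = 0" for i
  proof -
    \<comment> \<open>Subtracting \<open>q\<close> times this exact relation from the integer
      combination leaves only the approximation errors.\<close>
    have c0: "(\<Sum>x\<in>F. c x * real_of_int (x $ i)) = 0"
      using arg_cong[OF rel, of "\<lambda>v. v $ i"] by simp
    have "real_of_int ((\<Sum>x\<in>F. p x *s x) $ i) = (\<Sum>x\<in>F. of_int (p x) * real_of_int (x $ i))"
      by simp
    also have "\<dots> = (\<Sum>x\<in>F. of_int (p x) * real_of_int (x $ i)) - of_int q * (\<Sum>x\<in>F. c x * real_of_int (x $ i))"
      by (simp add: c0)
    also have "\<dots> = (\<Sum>x\<in>F. (of_int (p x) - of_int q * c x) * real_of_int (x $ i))"
      by (simp add: sum_distrib_left sum_subtractf algebra_simps)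
    finally have "\<bar>real_of_int ((\<Sum>x\<in>F. p x *s x) $ i)\<bar> \<le> (\<Sum>x\<in>F. \<bar>of_int (p x) - of_int q * c x\<bar> * \<bar>real_of_int (x $ i)\<bar>)"
      using sum_abs[of "\<lambda>x. (of_int (p x) - of_int q * c x) * real_of_int (x $ i)" F] by (simp add: abs_mult)
    also have "\<dots> \<le> (\<Sum>x\<in>F. 1 / real N * (\<Sum>i\<in>UNIV. \<bar>real_of_int (x $ i)\<bar>))"
    proof (intro sum_mono mult_mono)
      fix x assume "x \<in> F"
      then show "\<bar>of_int (p x) - of_int q * c x\<bar> \<le> 1 / real N"
        using p[of x] by linarith
      show "\<bar>real_of_int (x $ i)\<bar> \<le> (\<Sum>i\<in>UNIV. \<bar>real_of_int (x $ i)\<bar>)"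
        by (rule member_le_sum) auto
    qed auto
    also have "\<dots> = (B - 1) / real N"
      by (simp add: B_def sum_divide_distrib)
    also have "\<dots> < 1"
      using N N0 by simp
    finally show ?thesis by linarith
  qed
  ultimately show thesis
    by (intro that[of p]) (auto simp: vec_eq_iff)
qed

section \<open>Closure properties of subsemigroups and generated groups\<close>

lemma subsemigroup_scale:
  fixes S :: "(int ^ 'd) set"
  assumes S: "subsemigroup S" and x: "x \<in> S" and n: "0 < n"
  shows "n *s x \<in> S"
  using n
proof (induction n rule: int_gr_induct)
  case base
  show ?case using x by simp
next
  case (step n)
  then show ?case
    using S x by (simp add: subsemigroup_def)
qed

lemma subsemigroup_sum:
  fixes S :: "'a :: comm_monoid_add set"
  assumes S: "subsemigroup S" and "finite F" "F \<noteq> {}" "\<And>x. x \<in> F \<Longrightarrow> f x \<in> S"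
  shows "sum f F \<in> S"
  using assms(2-4)
  by (induction F rule: finite_ne_induct) (use S in \<open>auto simp: subsemigroup_def\<close>)

lemma group_gen_eq_if_uminus_closed:
  fixes S :: "'a :: ab_group_add set"
  assumes S: "subsemigroup S" and "S \<noteq> {}" and neg: "\<And>x. x \<in> S \<Longrightarrow> - x \<in> S"
  shows "group_gen S = S"
proof
  obtain s where "s \<in> S" using assms by blast
  then have "s + - s \<in> S" using S neg unfolding subsemigroup_def by blast
  then have "0 \<in> S" by simp
  show "group_gen S \<subseteq> S"
  proof
    fix x assume "x \<in> group_gen S"
    then show "x \<in> S"
      by induction (use S neg \<open>0 \<in> S\<close> in \<open>auto simp: subsemigroup_def\<close>)
  qed
qed (auto intro: gg_base)

lemma group_gen_orthogonal:
  assumes "\<And>h. h \<in> A \<Longrightarrow> v \<bullet> real_vec h = 0" "x \<in> group_gen A"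
  shows "v \<bullet> real_vec x = 0"
  using assms(2)
proof induction
  case (gg_add x y)
  have "real_vec (x + y) = real_vec x + real_vec y" by (simp add: vec_eq_iff)
  then show ?case using gg_add by (simp add: inner_add_right)
next
  case gg_zero
  have "real_vec 0 = (0 :: real ^ 'a)" by (simp add: vec_eq_iff)
  then show ?case by simp
qed (auto simp: assms real_vec_uminus)

text \<open>Orthogonality passes from \<open>A\<close> to the group it generates, which contains the
  standard unit vectors.\<close>

lemma group_gen_eq_UNIV_orthogonal:
  assumes "\<And>h. h \<in> A \<Longrightarrow> v \<bullet> real_vec h = 0" "group_gen A = UNIV"
  shows "v = 0"
proof -
  have "v $ i = 0" for i
  proof -
    have "real_vec (axis i 1) = axis i 1"
      by (auto simp: vec_eq_iff axis_def)
    then have "v \<bullet> axis i 1 = 0"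
      using group_gen_orthogonal[of A v "axis i 1"] assms by simp
    then show ?thesis by (simp add: inner_axis)
  qed
  then show ?thesis by (simp add: vec_eq_iff)
qed

text \<open>A point outside the cone could be separated from it by a hyperplane. A linear functional
  that is bounded below on a cone is nonnegative there, so the normal vector would contradict the
  hypothesis.\<close>

lemma convex_cone_hull_eq_UNIV:
  fixes S :: "'a :: euclidean_space set"
  assumes "\<And>v. (\<And>s. s \<in> S \<Longrightarrow> 0 \<le> v \<bullet> s) \<Longrightarrow> v = 0"
  shows "convex_cone hull S = UNIV"
proof (rule ccontr)
  let ?K = "convex_cone hull S"
  assume "?K \<noteq> UNIV"
  then obtain y where y: "y \<notin> ?K" by blast
  have "convex ?K"
    using convex_cone_convex_cone_hull[of S] by (simp add: convex_cone_def)
  then have "convex ((\<lambda>x. x - y) ` ?K)"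
    by (simp add: convex_translation_subtract)
  moreover have "0 \<notin> (\<lambda>x. x - y) ` ?K" using y by auto
  ultimately obtain a where a: "a \<noteq> 0" "\<And>x. x \<in> ?K \<Longrightarrow> a \<bullet> y \<le> a \<bullet> x"
    using separating_hyperplane_set_0[of "(\<lambda>x. x - y) ` ?K"] by (auto simp: inner_diff_right)
  have "0 \<le> a \<bullet> s" if s: "s \<in> S" for s
  proof (rule ccontr)
    assume neg: "\<not> 0 \<le> a \<bullet> s"
    \<comment> \<open>Scaling \<open>s\<close> by \<open>t\<close> brings the functional to
      \<open>- (\<bar>a \<bullet> y\<bar> + 1)\<close>, which is below its lower bound
      \<open>a \<bullet> y\<close>.\<close>
    define t where "t = (\<bar>a \<bullet> y\<bar> + 1) / - (a \<bullet> s)"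
    have "0 \<le> t" unfolding t_def using neg by (intro divide_nonneg_pos) auto
    moreover have "s \<in> ?K" using s by (rule hull_inc)
    ultimately have "t *\<^sub>R s \<in> ?K"
      using convex_cone_hull_mul by blast
    then have "a \<bullet> y \<le> t * (a \<bullet> s)" using a(2) by fastforce
    also have "\<dots> = - (\<bar>a \<bullet> y\<bar> + 1)" using neg by (simp add: t_def field_simps)
    finally show False by linarith
  qed
  with assms a(1) show False by blast
qed

text \<open>Since \<open>S\<close> spans the whole space as a real cone, \<open>- g\<close> is a
  nonnegative real combination of elements of \<open>S\<close> for each \<open>g\<close> in
  \<open>S\<close>. Moving \<open>g\<close> to the other side gives a relation in which
  \<open>g\<close> has positive weight; its integer version, solved for \<open>- g\<close>, shows
  that \<open>S\<close> is closed under negation and hence is the group it generates.\<close>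

lemma subsemigroup_eq_UNIV_if_dual_cone_trivial:
  fixes S :: "(int ^ 'd) set"
  assumes S: "subsemigroup S" and gen: "group_gen S = UNIV" and dual: "dual_cone S \<subseteq> {0}"
  shows "S = UNIV"
proof -
  \<comment> \<open>The dual cone of the empty set would be everything, including the all-ones
    vector.\<close>
  have "(1 :: real ^ 'd) \<notin> dual_cone S"
    using dual by (auto simp: vec_eq_iff)
  then have ne: "S \<noteq> {}" by (auto simp: dual_cone_def)
  have hull: "convex_cone hull (real_vec ` S) = UNIV"
    using dual by (intro convex_cone_hull_eq_UNIV) (auto simp: dual_cone_def)
  have inj: "inj (real_vec :: int ^ 'd \<Rightarrow> _)"
    by (auto simp: inj_def vec_eq_iff)
  have "- g \<in> S" if g: "g \<in> S" for g
  proof -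
    have "- real_vec g \<in> convex_cone hull (real_vec ` S)" using hull by simp
    then obtain t y where t: "0 \<le> t" and y: "y \<in> convex hull (real_vec ` S)" "- real_vec g = t *\<^sub>R y"
      using ne by (auto simp: convex_cone_hull_convex_hull_nonempty)
    from y(1) obtain T u where T: "finite T" "T \<subseteq> real_vec ` S" "\<And>v. v \<in> T \<Longrightarrow> 0 \<le> u v"
      and sum_T: "(\<Sum>v\<in>T. u v *\<^sub>R v) = y"
      unfolding convex_hull_explicit by blast
    have eq: "- real_vec g = t *\<^sub>R (\<Sum>v\<in>T. u v *\<^sub>R v)"
      by (simp only: y(2) sum_T)
    obtain F0 where F0: "F0 \<subseteq> S" "T = real_vec ` F0" "finite F0"
      using T(1,2) finite_subset_image by metis
    have eq': "- real_vec g = (\<Sum>x\<in>F0. (t * u (real_vec x)) *\<^sub>R real_vec x)"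
      unfolding eq F0(2) by (subst sum.reindex) (auto intro: inj_on_subset[OF inj] simp: scaleR_sum_right)
    \<comment> \<open>The weights of \<open>- g\<close> plus an extra 1 at \<open>g\<close>. The two
      summands are separate because \<open>g\<close> may or may not lie in
      \<open>F0\<close>.\<close>
    define wt where "wt x = (if x \<in> F0 then t * u (real_vec x) else 0) + (if x = g then 1 else 0)" for x
    have wt_nonneg: "0 \<le> wt x" for x
      using t T(3)[of "real_vec x"] F0 by (simp add: wt_def)
    \<comment> \<open>Zero weights are discarded, as the passage to integers requires strictly
      positive ones; \<open>g\<close> survives because its weight is at least 1.\<close>
    define F where "F = {x \<in> insert g F0. wt x \<noteq> 0}"
    have "(\<Sum>x\<in>F. wt x *\<^sub>R real_vec x) = (\<Sum>x\<in>insert g F0. wt x *\<^sub>R real_vec x)"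
      unfolding F_def using F0 by (intro sum.mono_neutral_left) auto
    also have "\<dots> = (\<Sum>x\<in>insert g F0. (if x \<in> F0 then t * u (real_vec x) else 0) *\<^sub>R real_vec x)
        + (\<Sum>x\<in>insert g F0. (if x = g then 1 else 0) *\<^sub>R real_vec x)"
      unfolding wt_def scaleR_left_distrib by (rule sum.distrib)
    also have "(\<Sum>x\<in>insert g F0. (if x = g then 1 else 0) *\<^sub>R real_vec x)
        = (\<Sum>x\<in>{g}. (if x = g then 1 else 0) *\<^sub>R real_vec x)"
      using F0 by (intro sum.mono_neutral_right) auto
    also have "(\<Sum>x\<in>insert g F0. (if x \<in> F0 then t * u (real_vec x) else 0) *\<^sub>R real_vec x)
        = (\<Sum>x\<in>F0. (if x \<in> F0 then t * u (real_vec x) else 0) *\<^sub>R real_vec x)"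
      using F0 by (intro sum.mono_neutral_right) auto
    also have "\<dots> = - real_vec g" unfolding eq' by (intro sum.cong) auto
    finally have rel: "(\<Sum>x\<in>F. wt x *\<^sub>R real_vec x) = 0" by simp
    have F: "finite F" "F \<subseteq> S" using F0 g by (auto simp: F_def)
    have "0 < wt x" if "x \<in> F" for x
      using wt_nonneg[of x] that by (auto simp: F_def less_le)
    then obtain p where p: "\<And>x. x \<in> F \<Longrightarrow> 0 < p x" "(\<Sum>x\<in>F. p x *s x) = 0"
      using positive_integer_relation[OF F(1) _ rel] by metis
    have "0 \<le> t * u (real_vec g)" if "g \<in> F0"
      using t T(3)[of "real_vec g"] F0 that by simp
    then have "g \<in> F" by (auto simp: F_def wt_def)
    define R where "R = (\<Sum>x\<in>F - {g}. p x *s x)"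
    have sum0: "p g *s g + R = 0"
      using p(2) F(1) \<open>g \<in> F\<close> unfolding R_def by (subst (asm) sum.remove[of _ g]) auto
    \<comment> \<open>\<open>S\<close> is not yet known to contain 0, so an empty remainder is a
      case of its own.\<close>
    have R: "R = 0 \<or> R \<in> S"
    proof (cases "F - {g} = {}")
      case False
      then have "R \<in> S" unfolding R_def
        using F p(1) by (intro subsemigroup_sum[OF S]) (auto intro: subsemigroup_scale[OF S])
      then show ?thesis ..
    next
      case True
      then show ?thesis unfolding R_def by (simp only: sum.empty simp_thms)
    qed
    have minus_g: "- g = (p g - 1) *s g + R"
      using sum0 by (simp add: vec_eq_iff algebra_simps eq_neg_iff_add_eq_0)
    have pg: "p g = 1 \<or> (p g - 1) *s g \<in> S"
      using p(1)[OF \<open>g \<in> F\<close>] subsemigroup_scale[OF S g, of "p g - 1"] by linarith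
    \<comment> \<open>Here the relation says \<open>g = 0\<close>, so \<open>- g\<close> is
      \<open>g\<close> itself.\<close>
    have zero: "- g \<in> S" if "R = 0" "p g = 1"
      using minus_g that g by auto
    from R pg show ?thesis
      using S zero minus_g unfolding subsemigroup_def
      by (metis add.left_neutral add.right_neutral diff_self vector_smult_lzero)
  qed
  then show ?thesis
    using group_gen_eq_if_uminus_closed[OF S ne] gen by simp
qed

text \<open>The hypothesis makes the closure of \<open>P\<close> a subspace, which is its own
  relative interior. A convex set has the same relative interior as its closure, so the closure lies
  in \<open>P\<close>.\<close>

lemma convex_cone_uminus_closed:
  fixes P :: "'a :: euclidean_space set"
  assumes P: "convex_cone P" and neg: "\<And>v. v \<in> P \<Longrightarrow> - v \<in> closure P" and v: "v \<in> P"
  shows "- v \<in> P"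
proof -
  have conv: "convex P" "conic P" "P \<noteq> {}"
    using P by (auto simp: convex_cone_def)
  have "- x \<in> closure P" if "x \<in> closure P" for x
  proof -
    have "- x \<in> uminus ` closure P" using that by blast
    also have "\<dots> = closure (uminus ` P)"
      using closure_scaleR[of "-1" P] by (simp add: scaleR_minus1_left[abs_def])
    also have "\<dots> \<subseteq> closure P" by (rule closure_minimal) (use neg in auto)
    finally show ?thesis .
  qed
  moreover have "convex_cone (closure P)"
    using conv by (auto simp: convex_cone_def intro: conic_closure)
  ultimately have "affine (closure P)"
    by (simp add: subspace_convex_cone_symmetric subspace_imp_affine)
  then have "closure P = rel_interior (closure P)"
    by (simp add: affine_closed rel_interior_affine)
  also have "\<dots> = rel_interior P"
    using conv(1) by (rule convex_rel_interior_closure)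
  finally show ?thesis
    using neg[OF v] rel_interior_subset by blast
qed

subsection \<open>Random subsemigroups\<close>

lemma space_subsets_measure [simp]: "space subsets_measure = UNIV"
  by (simp add: subsets_measure_def)

lemma sets_subsets_measure: "sets subsets_measure = sigma_sets UNIV {{A. g \<in> A} | g. True}"
  by (simp add: subsets_measure_def)

lemma sets_Collect_member [measurable]: "{A. g \<in> A} \<in> sets subsets_measure"
  unfolding sets_subsets_measure by (rule sigma_sets.Basic) blast

lemma sets_Collect_finite_subset:
  assumes "finite F"
  shows "{A. F \<subseteq> A} \<in> sets subsets_measure"
proof -
  have "{A. F \<subseteq> A} = space subsets_measure \<inter> (\<Inter>g\<in>F. {A. g \<in> A})" by auto
  also have "\<dots> \<in> sets subsets_measure"
  proof (cases "F = {}")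
    case False
    then show ?thesis using assms
      by (intro sets.Int sets.top sets.finite_INT sets_Collect_member)
  qed (use sets.top[of subsets_measure] in simp)
  finally show ?thesis .
qed

lemma measurable_subsets_measureI:
  fixes f :: "'a \<Rightarrow> 'b set"
  assumes "\<And>g. {\<omega> \<in> space M. g \<in> f \<omega>} \<in> sets M"
  shows "f \<in> M \<rightarrow>\<^sub>M subsets_measure"
  unfolding subsets_measure_def
proof (rule measurable_measure_of)
  fix B :: "'b set set" assume "B \<in> {{A. g \<in> A} | g. True}"
  then obtain g where B: "B = {A. g \<in> A}" by blast
  have "f -` B \<inter> space M = {\<omega> \<in> space M. g \<in> f \<omega>}" by (auto simp: B)
  then show "f -` B \<inter> space M \<in> sets M" using assms by simp
qed auto

lemma measurable_uminus_image:
  "(`) uminus \<in> subsets_measure \<rightarrow>\<^sub>M (subsets_measure :: 'a :: ab_group_add set measure)"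
proof (rule measurable_subsets_measureI)
  fix g :: 'a
  have "{A. g \<in> uminus ` A} = {A. - g \<in> A}" by force
  then show "{A \<in> space subsets_measure. g \<in> uminus ` A} \<in> sets subsets_measure"
    by (simp add: sets_Collect_member)
qed

text \<open>By compactness, only the finite subsets of \<open>A\<close> decide whether its dual cone meets \<open>K\<close>.\<close>

lemma sets_dual_cone_meets_compact:
  fixes K :: "(real ^ 'd) set"
  assumes K: "compact K"
  shows "{A. dual_cone A \<inter> K \<noteq> {}} \<in> sets subsets_measure"
proof -
  \<comment> \<open>The lattice has only countably many finite subsets, so missing \<open>K\<close>
    becomes a countable union of the events \<open>F \<subseteq> A\<close>.\<close>
  define \<F> where "\<F> = {F :: (int ^ 'd) set. finite F \<and> dual_cone F \<inter> K = {}}"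
  have "{A. dual_cone A \<inter> K = {}} = (\<Union>F\<in>\<F>. {A. F \<subseteq> A})"
  proof safe
    fix A assume A: "dual_cone A \<inter> K = {}"
    show "A \<in> (\<Union>F\<in>\<F>. {A. F \<subseteq> A})"
    proof (rule ccontr)
      assume "A \<notin> (\<Union>F\<in>\<F>. {A. F \<subseteq> A})"
      then have fin: "dual_cone F \<inter> K \<noteq> {}" if "finite F" "F \<subseteq> A" for F
        using that by (auto simp: \<F>_def)
      have "K \<inter> (\<Inter>h\<in>A. {v. 0 \<le> v \<bullet> real_vec h}) \<noteq> {}"
      proof (rule compact_imp_fip_image[OF K])
        fix h :: "int ^ 'd"
        have "{v. 0 \<le> v \<bullet> real_vec h} = {v. real_vec h \<bullet> v \<ge> 0}"
          by (auto simp: inner_commute)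
        then show "closed {v. 0 \<le> v \<bullet> real_vec h}"
          by (simp add: closed_halfspace_ge)
      next
        fix F assume "finite F" "F \<subseteq> A"
        from fin[OF this] show "K \<inter> (\<Inter>h\<in>F. {v. 0 \<le> v \<bullet> real_vec h}) \<noteq> {}"
          by (auto simp: dual_cone_def)
      qed
      with A show False by (auto simp: dual_cone_def)
    qed
  next
    fix A F v assume "F \<in> \<F>" "F \<subseteq> A" "v \<in> dual_cone A" "v \<in> K"
    then show "v \<in> {}" using dual_cone_antimono[of F A] by (auto simp: \<F>_def)
  qed
  also have "\<dots> \<in> sets subsets_measure"
  proof (intro sets.countable_UN'')
    show "countable \<F>"
      unfolding \<F>_def by (rule countable_subset[OF _ countable_Collect_finite]) auto
  qed (auto simp: \<F>_def intro: sets_Collect_finite_subset)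
  finally have "space subsets_measure - {A. dual_cone A \<inter> K = {}} \<in> sets subsets_measure"
    by (rule sets.compl_sets)
  moreover have "space subsets_measure - {A. dual_cone A \<inter> K = {}} = {A. dual_cone A \<inter> K \<noteq> {}}"
    by auto
  ultimately show ?thesis by simp
qed

section \<open>Triviality of the dual cones, for one sample and then almost surely\<close>

lemma decreasing_subset:
  assumes "\<And>n. (A :: nat \<Rightarrow> 'a set) (Suc n) \<subseteq> A n" "m \<le> n"
  shows "A n \<subseteq> A m"
  using assms(2) by (induction rule: dec_induct) (use assms(1) in blast)+

text \<open>The argument for a single sample. Symmetry is assumed only for balls centred in a dense
  set \<open>D\<close> with radii \<open>1 / Suc k\<close>; for countable \<open>D\<close> this is a
  countable family of conditions, which can hold simultaneously almost surely.\<close>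

lemma dual_cone_trivial:
  fixes A :: "nat \<Rightarrow> (int ^ 'd) set"
  assumes dec: "\<And>n. A (Suc n) \<subseteq> A n" and gen: "\<And>n. group_gen (A n) = UNIV"
    and D: "\<And>X. open X \<Longrightarrow> X \<noteq> {} \<Longrightarrow> \<exists>q\<in>D. q \<in> X"
    and sym: "\<And>q k. q \<in> D \<Longrightarrow> (\<exists>n. dual_cone (A n) \<inter> cball q (1 / Suc k) \<noteq> {}) \<Longrightarrow>
      \<exists>n. dual_cone (A n) \<inter> cball (- q) (1 / Suc k) \<noteq> {}"
  shows "dual_cone (A n) \<subseteq> {0}"
proof
  fix v assume v: "v \<in> dual_cone (A n)"
  define P where "P = (\<Union>n. dual_cone (A n))"
  have mono: "dual_cone (A m) \<subseteq> dual_cone (A n)" if "m \<le> n" for m n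
    using decreasing_subset[of A, OF dec that] by (rule dual_cone_antimono)
  have P: "convex_cone P"
    unfolding convex_cone_iff
  proof (intro conjI ballI allI impI)
    show "0 \<in> P" by (auto simp: P_def dual_cone_def)
  next
    fix x y assume "x \<in> P" "y \<in> P"
    then obtain m n where "x \<in> dual_cone (A m)" "y \<in> dual_cone (A n)" by (auto simp: P_def)
    then have "x \<in> dual_cone (A (max m n))" "y \<in> dual_cone (A (max m n))"
      using mono[of m "max m n"] mono[of n "max m n"] by auto
    then show "x + y \<in> P"
      using convex_cone_add[OF convex_cone_dual_cone] unfolding P_def by blast
  next
    fix x and c :: real assume "x \<in> P" "0 \<le> c"
    then show "c *\<^sub>R x \<in> P"
      using convex_cone_dual_cone unfolding P_def convex_cone_iff by blast
  qed
  have "- w \<in> closure P" if w: "w \<in> P" for w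
    unfolding closure_approachable
  proof (intro allI impI)
    fix e :: real assume "0 < e"
    then obtain k where k: "1 / real (Suc k) < e / 2"
      using nat_approx_posE half_gt_zero by metis
    obtain q where q: "q \<in> D" "q \<in> ball w (1 / Suc k)"
      using D[of "ball w (1 / Suc k)"] by auto
    then have "w \<in> cball q (1 / Suc k)" by (simp add: dist_commute)
    then have "\<exists>n. dual_cone (A n) \<inter> cball q (1 / Suc k) \<noteq> {}"
      using w unfolding P_def by blast
    from sym[OF q(1) this] obtain y where y: "y \<in> P" "y \<in> cball (- q) (1 / Suc k)"
      unfolding P_def by blast
    have "dist (- q) (- w) = dist w q"
      by (simp add: dist_norm norm_minus_commute)
    then have "dist (- q) (- w) \<le> 1 / Suc k" using q(2) by simp
    moreover have "dist y (- q) \<le> 1 / Suc k" using y(2) by (simp add: dist_commute)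
    ultimately have "dist y (- w) < e"
      using k dist_triangle[of y "- w" "- q"] by linarith
    then show "\<exists>y\<in>P. dist y (- w) < e" using y(1) by blast
  qed
  from convex_cone_uminus_closed[OF P this] v obtain m where "- v \<in> dual_cone (A m)"
    unfolding P_def by blast
  then have "v \<in> dual_cone (A (max m n))" "- v \<in> dual_cone (A (max m n))"
    using v mono[of m "max m n"] mono[of n "max m n"] by auto
  \<comment> \<open>Both signs of \<open>v\<close> are nonnegative on the same set, so the inner
    products vanish.\<close>
  then have "\<And>h. h \<in> A (max m n) \<Longrightarrow> v \<bullet> real_vec h = 0"
    by (force simp: dual_cone_def)
  from group_gen_eq_UNIV_orthogonal[OF this gen] show "v \<in> {0}" by simp
qed

context prob_space
begin

text \<open>The core shared by both claims. The 0-1 law enters as the assumption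
  \<open>zero_one\<close>, so that either a trivial tail or the Hewitt-Savage law can supply
  it.\<close>

lemma AE_subsemigroups_eq_UNIV:
  fixes H :: "nat \<Rightarrow> 'a \<Rightarrow> (int ^ 'd) set"
  assumes meas: "\<And>n. H n \<in> M \<rightarrow>\<^sub>M subsets_measure"
    and semi: "\<And>n \<omega>. \<omega> \<in> space M \<Longrightarrow> subsemigroup (H n \<omega>)"
    and dec: "\<And>n \<omega>. \<omega> \<in> space M \<Longrightarrow> H (Suc n) \<omega> \<subseteq> H n \<omega>"
    and gen: "AE \<omega> in M. \<forall>n. group_gen (H n \<omega>) = UNIV"
    and zero_one: "\<And>K. compact K \<Longrightarrow>
      prob {\<omega> \<in> space M. \<exists>n. dual_cone (H n \<omega>) \<inter> K \<noteq> {}} \<in> {0, 1}"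
    and sym: "\<And>n. distr M subsets_measure (H n) = distr M subsets_measure (\<lambda>\<omega>. uminus ` H n \<omega>)"
  shows "AE \<omega> in M. \<forall>n. H n \<omega> = UNIV"
proof -
  define E where "E K n = {\<omega> \<in> space M. dual_cone (H n \<omega>) \<inter> K \<noteq> {}}" for K n
  define U where "U K = {\<omega> \<in> space M. \<exists>n. dual_cone (H n \<omega>) \<inter> K \<noteq> {}}" for K
  have E_alt: "E K n = H n -` {A. dual_cone A \<inter> K \<noteq> {}} \<inter> space M" for K n
    by (auto simp: E_def)
  have E_sets: "E K n \<in> events" if "compact K" for K n
    unfolding E_alt by (rule measurable_sets[OF meas sets_dual_cone_meets_compact[OF that]])
  have U_alt: "U K = (\<Union>n. E K n)" for K
    by (auto simp: U_def E_def)
  have U_sets: "U K \<in> events" if "compact K" for K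
    unfolding U_alt using E_sets[OF that] by auto
  have E_mono: "incseq (E K)" for K
  proof (rule incseq_SucI)
    fix n
    show "E K n \<subseteq> E K (Suc n)"
      using dual_cone_antimono[OF dec[of _ n]] by (fastforce simp: E_def)
  qed
  \<comment> \<open>Negating a set negates its dual cone, so equality of laws exchanges
    \<open>K\<close> and its negative.\<close>
  have prob_E: "prob (E K n) = prob (E (uminus ` K) n)" if K: "compact K" for K n
  proof -
    let ?B = "{A. dual_cone A \<inter> K \<noteq> {}}"
    have meets: "dual_cone (uminus ` A) \<inter> K \<noteq> {} \<longleftrightarrow> dual_cone A \<inter> uminus ` K \<noteq> {}" for A
      by (auto simp: dual_cone_uminus_image)
    have "prob (E K n) = measure (distr M subsets_measure (H n)) ?B"
      unfolding E_alt by (rule measure_distr[symmetric, OF meas sets_dual_cone_meets_compact[OF K]])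
    also have "\<dots> = prob ((\<lambda>\<omega>. uminus ` H n \<omega>) -` ?B \<inter> space M)"
      unfolding sym
      by (rule measure_distr[OF measurable_compose[OF meas measurable_uminus_image]
            sets_dual_cone_meets_compact[OF K]])
    also have "(\<lambda>\<omega>. uminus ` H n \<omega>) -` ?B \<inter> space M = E (uminus ` K) n"
      using meets by (auto simp only: E_def)
    finally show ?thesis .
  qed
  \<comment> \<open>Symmetry is given for each \<open>n\<close> separately. It reaches the union by
    continuity of the measure along increasing events.\<close>
  have prob_U: "prob (U K) = prob (U (uminus ` K))" if K: "compact K" for K
  proof -
    have "(\<lambda>n. prob (E K n)) \<longlonglongrightarrow> prob (U K)"
      unfolding U_alt using E_sets[OF K] by (intro finite_Lim_measure_incseq E_mono) auto
    moreover have "(\<lambda>n. prob (E K n)) \<longlonglongrightarrow> prob (U (uminus ` K))"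
      unfolding U_alt prob_E[OF K] using E_sets[OF compact_negations[OF K]]
      by (intro finite_Lim_measure_incseq E_mono) auto
    ultimately show ?thesis by (rule LIMSEQ_unique)
  qed
  \<comment> \<open>By the 0-1 law either \<open>U K\<close> is null, or both \<open>U K\<close> and
    its mirror event have probability 1.\<close>
  have AE_U: "AE \<omega> in M. \<omega> \<in> U K \<longrightarrow> \<omega> \<in> U (uminus ` K)" if K: "compact K" for K
  proof (cases "prob (U K) = 0")
    case True
    then have "AE \<omega> in M. \<omega> \<notin> U K" using prob_eq_0[OF U_sets[OF K]] by simp
    then show ?thesis by eventually_elim simp
  next
    case False
    then have "prob (U (uminus ` K)) = 1"
      using zero_one[OF K] prob_U[OF K] by (simp add: U_def)
    then have "AE \<omega> in M. \<omega> \<in> U (uminus ` K)"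
      using prob_eq_1[OF U_sets[OF compact_negations[OF K]]] by simp
    then show ?thesis by eventually_elim simp
  qed
  obtain D :: "(real ^ 'd) set" where D: "countable D"
    "\<And>X. open X \<Longrightarrow> X \<noteq> {} \<Longrightarrow> \<exists>d\<in>D. d \<in> X"
    using countable_dense_setE by blast
  have neg_cball: "uminus ` cball q r = cball (- q) r" for q :: "real ^ 'd" and r
  proof -
    have "dist (- q) x = dist q (- x)" for x
      by (metis dist_minus minus_minus)
    then show ?thesis by (force simp: image_iff)
  qed
  have "AE \<omega> in M. \<forall>q\<in>D. \<forall>k. \<omega> \<in> U (cball q (1 / Suc k)) \<longrightarrow> \<omega> \<in> U (cball (- q) (1 / Suc k))"
    unfolding AE_ball_countable[OF D(1)] AE_all_countable
    using AE_U[OF compact_cball] by (simp add: neg_cball)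
  with gen AE_space show ?thesis
  proof eventually_elim
    case (elim \<omega>)
    then have "dual_cone (H n \<omega>) \<subseteq> {0}" for n
      by (intro dual_cone_trivial[of "\<lambda>n. H n \<omega>", OF _ _ D(2)]) (use dec in \<open>auto simp: U_def\<close>)
    then show ?case
      using subsemigroup_eq_UNIV_if_dual_cone_trivial[OF semi] elim by blast
  qed
qed

text \<open>The cones increase with \<open>n\<close>, so dropping the first \<open>m\<close> terms
  does not change whether some cone meets \<open>K\<close>. This makes the event a tail
  event.\<close>

lemma AE_Liouville_subsemigroups_eq_UNIV:
  fixes H :: "nat \<Rightarrow> 'a \<Rightarrow> (int ^ 'd) set"
  assumes meas: "\<And>n. H n \<in> M \<rightarrow>\<^sub>M subsets_measure"
    and semi: "\<And>n \<omega>. \<omega> \<in> space M \<Longrightarrow> subsemigroup (H n \<omega>)"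
    and dec: "\<And>n \<omega>. \<omega> \<in> space M \<Longrightarrow> H (Suc n) \<omega> \<subseteq> H n \<omega>"
    and gen: "AE \<omega> in M. \<forall>n. group_gen (H n \<omega>) = UNIV"
    and tail: "\<And>A. A \<in> tail_events (\<lambda>k. {H k -` B \<inter> space M | B. B \<in> sets subsets_measure}) \<Longrightarrow>
      prob A = 0 \<or> prob A = 1"
    and sym: "\<And>n. distr M subsets_measure (H n) = distr M subsets_measure (\<lambda>\<omega>. uminus ` H n \<omega>)"
  shows "AE \<omega> in M. \<forall>n. H n \<omega> = UNIV"
proof (rule AE_subsemigroups_eq_UNIV[OF meas semi dec gen _ sym])
  fix K :: "(real ^ 'd) set" assume K: "compact K"
  let ?F = "\<lambda>k. {H k -` B \<inter> space M | B. B \<in> sets subsets_measure}"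
  have "{\<omega> \<in> space M. \<exists>n. dual_cone (H n \<omega>) \<inter> K \<noteq> {}} \<in> tail_events ?F"
    unfolding tail_events_def
  proof (rule INT_I)
    fix m
    have "{\<omega> \<in> space M. \<exists>n. dual_cone (H n \<omega>) \<inter> K \<noteq> {}}
        = (\<Union>n. H (n + m) -` {A. dual_cone A \<inter> K \<noteq> {}} \<inter> space M)"
    proof (intro equalityI subsetI)
      fix \<omega> assume "\<omega> \<in> {\<omega> \<in> space M. \<exists>n. dual_cone (H n \<omega>) \<inter> K \<noteq> {}}"
      then obtain n where n: "\<omega> \<in> space M" "dual_cone (H n \<omega>) \<inter> K \<noteq> {}" by blast
      then have "H (n + m) \<omega> \<subseteq> H n \<omega>"
        by (intro decreasing_subset[of "\<lambda>n. H n \<omega>", OF dec]) auto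
      then have "dual_cone (H n \<omega>) \<subseteq> dual_cone (H (n + m) \<omega>)"
        by (rule dual_cone_antimono)
      with n show "\<omega> \<in> (\<Union>n. H (n + m) -` {A. dual_cone A \<inter> K \<noteq> {}} \<inter> space M)"
        by blast
    qed blast
    also have "\<dots> \<in> sigma_sets (space M) (\<Union> (?F ` {m..}))"
    proof (rule sigma_sets.Union, rule sigma_sets.Basic)
      fix n
      show "H (n + m) -` {A. dual_cone A \<inter> K \<noteq> {}} \<inter> space M \<in> \<Union> (?F ` {m..})"
        using sets_dual_cone_meets_compact[OF K] by (intro UN_I[of "n + m"]) (simp, blast)
    qed
    finally show "{\<omega> \<in> space M. \<exists>n. dual_cone (H n \<omega>) \<inter> K \<noteq> {}} \<in> sigma_sets (space M) (\<Union> (?F ` {m..}))" .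
  qed
  from tail[OF this] show "prob {\<omega> \<in> space M. \<exists>n. dual_cone (H n \<omega>) \<inter> K \<noteq> {}} \<in> {0, 1}" by simp
qed auto

end

subsection \<open>The Hewitt--Savage 0-1 law\<close>

context sequence_space
begin

text \<open>One implication suffices because \<open>\<omega>\<close> and \<open>\<omega>'\<close>
  may be exchanged. The pointwise form avoids representing \<open>B\<close> as a preimage from a
  finite product.\<close>

definition depends_on_first :: "nat \<Rightarrow> (nat \<Rightarrow> 'a) set \<Rightarrow> bool" where
  "depends_on_first n B \<longleftrightarrow>
    (\<forall>\<omega>\<in>space S. \<forall>\<omega>'\<in>space S. (\<forall>i<n. \<omega> i = \<omega>' i) \<longrightarrow> \<omega> \<in> B \<longrightarrow> \<omega>' \<in> B)"

lemma depends_on_first_mono: "depends_on_first m B \<Longrightarrow> m \<le> n \<Longrightarrow> depends_on_first n B"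
  unfolding depends_on_first_def by (meson less_le_trans)

lemma depends_on_first_compl: "depends_on_first n B \<Longrightarrow> depends_on_first n (space S - B)"
  unfolding depends_on_first_def by (metis DiffD2 DiffI)

lemma depends_on_first_UN:
  "(\<And>i. i \<in> I \<Longrightarrow> depends_on_first n (B i)) \<Longrightarrow> depends_on_first n (\<Union>i\<in>I. B i)"
  unfolding depends_on_first_def by blast

definition approximable :: "(nat \<Rightarrow> 'a) set \<Rightarrow> bool" where
  "approximable A \<longleftrightarrow> (\<forall>e>0. \<exists>n. \<exists>B\<in>sets S. depends_on_first n B \<and>
    measure S ((A - B) \<union> (B - A)) < e)"

text \<open>A finite partial union loses less than \<open>e / 2\<close>, and the approximations of
  its finitely many members together cost at most another \<open>e / 2\<close>.\<close>

lemma approximable_UN: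
  fixes A :: "nat \<Rightarrow> (nat \<Rightarrow> 'a) set"
  assumes sets: "\<And>i. A i \<in> sets S" and approx: "\<And>i. approximable (A i)"
  shows "approximable (\<Union>i. A i)"
  unfolding approximable_def
proof (intro allI impI)
  fix e :: real assume e: "0 < e"
  let ?U = "\<lambda>m. \<Union>i\<le>m. A i"
  have "(\<lambda>m. measure S (?U m)) \<longlonglongrightarrow> measure S (\<Union>m. ?U m)"
    using sets by (intro P.finite_Lim_measure_incseq incseq_SucI) (auto simp: le_Suc_eq)
  also have "(\<Union>m. ?U m) = (\<Union>i. A i)" by auto
  finally have lim: "(\<lambda>m. measure S (?U m)) \<longlonglongrightarrow> measure S (\<Union>i. A i)" .
  have "\<forall>\<^sub>F m in sequentially. measure S (\<Union>i. A i) - e / 2 < measure S (?U m)"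
    using e by (intro order_tendstoD(1)[OF lim]) simp
  then obtain m where m: "measure S (\<Union>i. A i) - e / 2 < measure S (?U m)"
    unfolding eventually_sequentially by blast
  \<comment> \<open>The indices 0 to \<open>m\<close> give \<open>Suc m\<close> sets, which share
    the remaining \<open>e / 2\<close>.\<close>
  define d where "d = e / (2 * real (Suc m))"
  have d: "0 < d" using e by (simp add: d_def)
  have "\<forall>i. \<exists>n B. B \<in> sets S \<and> depends_on_first n B \<and> measure S ((A i - B) \<union> (B - A i)) < d"
    using approx d unfolding approximable_def by metis
  then obtain n B where B: "\<And>i. B i \<in> sets S" "\<And>i. depends_on_first (n i) (B i)"
      "\<And>i. measure S ((A i - B i) \<union> (B i - A i)) < d"
    by metis
  define C where "C = (\<Union>i\<le>m. B i)"
  have C: "C \<in> sets S" using B(1) by (auto simp: C_def)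
  have "depends_on_first (Max (n ` {..m})) C"
    unfolding C_def by (intro depends_on_first_UN depends_on_first_mono[OF B(2)]) auto
  moreover have "measure S (((\<Union>i. A i) - C) \<union> (C - (\<Union>i. A i))) < e"
  proof -
    let ?D = "\<lambda>i. (A i - B i) \<union> (B i - A i)"
    have sub: "((\<Union>i. A i) - C) \<union> (C - (\<Union>i. A i)) \<subseteq> ((\<Union>i. A i) - ?U m) \<union> (\<Union>i\<le>m. ?D i)"
      unfolding C_def by blast
    have "measure S (((\<Union>i. A i) - C) \<union> (C - (\<Union>i. A i)))
        \<le> measure S (((\<Union>i. A i) - ?U m) \<union> (\<Union>i\<le>m. ?D i))"
      using sub sets B(1) by (intro P.finite_measure_mono) auto
    also have "\<dots> \<le> measure S ((\<Union>i. A i) - ?U m) + measure S (\<Union>i\<le>m. ?D i)"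
      using sets B(1) by (intro measure_Un_le) auto
    also have "measure S ((\<Union>i. A i) - ?U m) = measure S (\<Union>i. A i) - measure S (?U m)"
      using sets by (intro P.finite_measure_Diff) auto
    also have "measure S (\<Union>i\<le>m. ?D i) \<le> (\<Sum>i\<le>m. measure S (?D i))"
      using sets B(1) by (intro P.finite_measure_subadditive_finite) auto
    also have "\<dots> \<le> (\<Sum>i\<le>m. d)"
      using B(3) by (intro sum_mono less_imp_le)
    also have "\<dots> = e / 2" by (simp add: d_def field_simps)
    finally show ?thesis using m by linarith
  qed
  ultimately show "\<exists>n. \<exists>B\<in>sets S. depends_on_first n B \<and>
      measure S (((\<Union>i. A i) - B) \<union> (B - (\<Union>i. A i))) < e"
    using C by blast
qed

text \<open>Induction over the sigma-algebra generated by the coordinate events. Complements are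
  harmless because they leave the symmetric difference unchanged.\<close>

lemma approximable_sets:
  assumes "A \<in> sets S"
  shows "approximable A"
proof -
  have exact: "approximable A" if "A \<in> sets S" "depends_on_first n A" for A n
    using that unfolding approximable_def
    by (intro allI impI exI[of _ n] bexI[of _ A]) auto
  let ?G = "{{f \<in> \<Pi>\<^sub>E i\<in>UNIV. space M. f i \<in> A} | i A. i \<in> (UNIV :: nat set) \<and> A \<in> sets M}"
  have sets_S: "sets S = sigma_sets (space S) ?G"
    by (simp add: sets_PiM_single space_PiM)
  have "A \<in> sigma_sets (space S) ?G" using assms sets_S by simp
  then show ?thesis
  proof induction
    case (Basic a)
    then obtain i B where a: "a = {f \<in> space S. f i \<in> B}" "B \<in> sets M"
      by (auto simp: space_PiM)
    have "a \<in> sets S" unfolding sets_S using Basic by (rule sigma_sets.Basic)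
    \<comment> \<open>Coordinates are counted from 0, so coordinate \<open>i\<close> is among the
      first \<open>Suc i\<close>.\<close>
    then show ?case by (rule exact[of _ "Suc i"]) (auto simp: depends_on_first_def a)
  next
    case Empty
    show ?case by (rule exact[of _ 0]) (auto simp: depends_on_first_def)
  next
    case (Compl a)
    have a: "a \<in> sets S" unfolding sets_S by (rule Compl)
    show ?case unfolding approximable_def
    proof (intro allI impI)
      fix e :: real assume "0 < e"
      then obtain n B where B: "B \<in> sets S" "depends_on_first n B" "measure S ((a - B) \<union> (B - a)) < e"
        using Compl.IH unfolding approximable_def by blast
      have "(space S - a - (space S - B)) \<union> (space S - B - (space S - a)) = (a - B) \<union> (B - a)"
        using sets.sets_into_space[OF a] sets.sets_into_space[OF B(1)] by blast
      then show "\<exists>n. \<exists>B\<in>sets S. depends_on_first n B \<and>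
          measure S ((space S - a - B) \<union> (B - (space S - a))) < e"
        using B depends_on_first_compl by (intro exI[of _ n] bexI[of _ "space S - B"]) auto
    qed
  next
    case (Union a)
    then show ?case by (intro approximable_UN) (auto simp: sets_S)
  qed
qed

text \<open>Independence means that the joint law is the product of the marginals; here the joint
  variable is the identity on the product space.\<close>

lemma indep_vars_coordinates: "P.indep_vars (\<lambda>_. M) (\<lambda>i \<omega>. \<omega> i) UNIV"
proof (subst P.indep_vars_iff_distr_eq_PiM)
  have "distr S S (\<lambda>\<omega>. \<lambda>i\<in>UNIV. \<omega> i) = distr S S (\<lambda>\<omega>. \<omega>)"
    by (simp add: restrict_UNIV)
  also have "\<dots> = S" by (rule distr_id)
  also have "\<dots> = (\<Pi>\<^sub>M i\<in>UNIV. distr S M (\<lambda>\<omega>. \<omega> i))"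
    by (intro PiM_cong refl PiM_component[symmetric]) auto
  finally show "distr S S (\<lambda>\<omega>. \<lambda>i\<in>UNIV. \<omega> i) = (\<Pi>\<^sub>M i\<in>UNIV. distr S M (\<lambda>\<omega>. \<omega> i))" .
qed auto

section \<open>Measure-preserving maps of the product space and their consequences\<close>

lemma measurable_reindex: "(\<lambda>\<omega>. \<omega> \<circ> f) \<in> S \<rightarrow>\<^sub>M S"
  unfolding comp_def by (rule measurable_PiM_single') (auto simp: space_PiM PiE_iff)

text \<open>Stated for injections so that it covers shifts as well as permutations.\<close>

lemma distr_reindex:
  assumes "inj f"
  shows "distr S S (\<lambda>\<omega>. \<omega> \<circ> f) = S"
  using distr_PiM_reindex[of UNIV "\<lambda>_. M" f UNIV] assms M.prob_space_axioms
  by (simp add: comp_def restrict_UNIV)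

lemma measure_reindex:
  assumes "inj f" "A \<in> sets S"
  shows "measure S ((\<lambda>\<omega>. \<omega> \<circ> f) -` A \<inter> space S) = measure S A"
  using measure_distr[OF measurable_reindex[of f] assms(2)] distr_reindex[OF assms(1)] by simp

text \<open>Finite-dimensional boxes determine the product measure, and a coordinatewise map pulls
  boxes back to boxes with sides of equal measure. It is applied to negation of the
  increments.\<close>

lemma distr_comp_coordinates:
  assumes f: "f \<in> M \<rightarrow>\<^sub>M M" and inv: "distr M M f = M"
  shows "distr S S (\<lambda>\<omega>. f \<circ> \<omega>) = S"
proof (rule PiM_eq)
  have meas: "(\<lambda>\<omega>. f \<circ> \<omega>) \<in> S \<rightarrow>\<^sub>M S"
    unfolding comp_def
    by (rule measurable_PiM_single')
      (use f measurable_space[OF f] in \<open>auto simp: space_PiM PiE_iff intro: measurable_compose[OF measurable_component_singleton]\<close>)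
  fix J :: "nat set" and F :: "nat \<Rightarrow> 'a set"
  assume J: "finite J" and F: "\<And>j. j \<in> J \<Longrightarrow> F j \<in> sets M"
  have pre: "f -` F j \<inter> space M \<in> sets M" if "j \<in> J" for j
    using measurable_sets[OF f F[OF that]] .
  have "emeasure (distr S S (\<lambda>\<omega>. f \<circ> \<omega>)) (emb UNIV J (Pi\<^sub>E J F))
      = emeasure S ((\<lambda>\<omega>. f \<circ> \<omega>) -` emb UNIV J (Pi\<^sub>E J F) \<inter> space S)"
    using J F by (intro emeasure_distr meas) auto
  also have "(\<lambda>\<omega>. f \<circ> \<omega>) -` emb UNIV J (Pi\<^sub>E J F) \<inter> space S
      = emb UNIV J (\<Pi>\<^sub>E j\<in>J. f -` F j \<inter> space M)"
    using measurable_space[OF f] by (auto simp: prod_emb_def space_PiM PiE_iff)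
  also have "emeasure S \<dots> = (\<Prod>j\<in>J. emeasure M (f -` F j \<inter> space M))"
    using J pre by (intro emeasure_PiM_emb) auto
  also have "\<dots> = (\<Prod>j\<in>J. emeasure M (F j))"
    using emeasure_distr[OF f F] inv by (intro prod.cong) auto
  finally show "emeasure (distr S S (\<lambda>\<omega>. f \<circ> \<omega>)) (emb UNIV J (Pi\<^sub>E J F)) = (\<Prod>j\<in>J. emeasure M (F j))" .
qed simp

lemma AE_recurrent_value:
  assumes g: "{g} \<in> sets M" "0 < measure M {g}"
  shows "AE \<omega> in S. \<exists>i\<ge>n. \<omega> i = g"
proof -
  have compl: "space M - {g} \<in> sets M" using g(1) by auto
  have "measure M (space M - {g}) = 1 - measure M {g}"
    using M.prob_compl[OF g(1)] .
  \<comment> \<open>The powers are the probabilities of avoiding \<open>g\<close> in the first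
    \<open>Suc k\<close> coordinates.\<close>
  then have "(\<lambda>k. (1 - measure M {g}) ^ Suc k) \<longlonglongrightarrow> measure S (Pi UNIV (\<lambda>_. space M - {g}))"
    using measure_PiM_countable[of "\<lambda>_. space M - {g}"] compl by simp
  moreover have "(\<lambda>k. (1 - measure M {g}) ^ Suc k) \<longlonglongrightarrow> 0"
    using g(2) M.prob_le_1[of "{g}"] by (intro LIMSEQ_Suc LIMSEQ_realpow_zero) auto
  ultimately have "measure S (Pi UNIV (\<lambda>_. space M - {g})) = 0"
    by (rule LIMSEQ_unique)
  then have "AE \<omega> in S. \<omega> \<notin> Pi UNIV (\<lambda>_. space M - {g})"
    using P.prob_eq_0 compl by (simp add: infprod_in_sets)
  with AE_space have "AE \<omega> in S. \<exists>i. \<omega> i = g"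
    by eventually_elim (auto simp: space_PiM PiE_iff)
  \<comment> \<open>The shift by \<open>n\<close> preserves the law, so \<open>g\<close> also occurs
    from time \<open>n\<close> on.\<close>
  then have "AE \<omega> in distr S S (\<lambda>\<omega>. \<omega> \<circ> (\<lambda>i. i + n)). \<exists>i. \<omega> i = g"
    by (subst distr_reindex) (auto simp: inj_on_def)
  from AE_distrD[OF measurable_reindex this] show ?thesis
    by eventually_elim (auto intro: le_add2)
qed

text \<open>\<open>B\<close> looks only at coordinates below \<open>n\<close>, its reindexed copy
  only at coordinates from \<open>n\<close> on. Disjoint blocks are independent, and reindexing
  keeps the measure.\<close>

lemma indep_first_shifted:
  assumes B: "B \<in> sets S" "depends_on_first n B" and f: "\<And>i. i < n \<Longrightarrow> n \<le> f i" "inj f"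
  shows "measure S (B \<inter> ((\<lambda>\<omega>. \<omega> \<circ> f) -` B \<inter> space S)) = measure S B * measure S B"
proof -
  obtain x where x: "x \<in> space M" using M.not_empty by blast
  \<comment> \<open>\<open>r\<close> and \<open>s\<close> rebuild a full sequence from one block,
    with the constant \<open>x\<close> in the places that \<open>B\<close> ignores.\<close>
  define r where "r \<omega> i = (if i < n then \<omega> i else x)" for \<omega> and i :: nat
  have r: "r \<in> (\<Pi>\<^sub>M i\<in>{..<n}. M) \<rightarrow>\<^sub>M S"
    unfolding r_def[abs_def]
  proof (rule measurable_PiM_single')
    fix i :: nat
    show "(\<lambda>\<omega>. if i < n then \<omega> i else x) \<in> (\<Pi>\<^sub>M i\<in>{..<n}. M) \<rightarrow>\<^sub>M M"
      using x by (cases "i < n") auto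
  qed (use x in \<open>auto simp: space_PiM PiE_iff\<close>)
  define s where "s \<omega> i = (if i < n then \<omega> (f i) else x)" for \<omega> and i :: nat
  have s: "s \<in> (\<Pi>\<^sub>M i\<in>{n..}. M) \<rightarrow>\<^sub>M S"
    unfolding s_def[abs_def]
  proof (rule measurable_PiM_single')
    fix i :: nat
    show "(\<lambda>\<omega>. if i < n then \<omega> (f i) else x) \<in> (\<Pi>\<^sub>M i\<in>{n..}. M) \<rightarrow>\<^sub>M M"
      using x f(1)[of i] by (cases "i < n") auto
  qed (use x f(1) in \<open>auto simp: space_PiM PiE_iff\<close>)
  let ?R = "\<lambda>\<omega>. r (restrict \<omega> {..<n})" and ?T = "\<lambda>\<omega>. s (restrict \<omega> {n..})"
  have "P.indep_var (\<Pi>\<^sub>M i\<in>{..<n}. M) (\<lambda>\<omega>. restrict \<omega> {..<n}) (\<Pi>\<^sub>M i\<in>{n..}. M) (\<lambda>\<omega>. restrict \<omega> {n..})"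
    by (rule P.indep_var_restrict[OF indep_vars_coordinates]) auto
  from P.indep_var_compose[OF this r s]
  have ind: "P.indep_var S ?R S ?T" by (simp add: comp_def)
  have R: "?R \<omega> \<in> B \<longleftrightarrow> \<omega> \<in> B" if \<omega>: "\<omega> \<in> space S" for \<omega>
  proof -
    have "?R \<omega> \<in> space S" using \<omega> x by (auto simp: r_def space_PiM PiE_iff)
    moreover have "\<forall>i<n. ?R \<omega> i = \<omega> i" by (simp add: r_def)
    ultimately show ?thesis using B(2) \<omega> unfolding depends_on_first_def by metis
  qed
  have T: "?T \<omega> \<in> B \<longleftrightarrow> \<omega> \<circ> f \<in> B" if \<omega>: "\<omega> \<in> space S" for \<omega>
  proof -
    have "?T \<omega> \<in> space S" "\<omega> \<circ> f \<in> space S" using \<omega> x f(1) by (auto simp: s_def space_PiM PiE_iff)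
    moreover have "\<forall>i<n. ?T \<omega> i = (\<omega> \<circ> f) i" using f(1) by (simp add: s_def)
    ultimately show ?thesis using B(2) unfolding depends_on_first_def by metis
  qed
  have "?R -` B \<inter> space S = B"
    using R sets.sets_into_space[OF B(1)] by blast
  moreover have "?T -` B \<inter> space S = (\<lambda>\<omega>. \<omega> \<circ> f) -` B \<inter> space S"
    using T by blast
  moreover have "(\<lambda>\<omega>. (?R \<omega>, ?T \<omega>)) -` (B \<times> B) \<inter> space S = B \<inter> ((\<lambda>\<omega>. \<omega> \<circ> f) -` B \<inter> space S)"
    using R T sets.sets_into_space[OF B(1)] by blast
  ultimately show ?thesis
    using P.indep_varD[OF ind B(1) B(1)] measure_reindex[OF f(2) B(1)] by simp
qed

text \<open>Approximate \<open>A\<close> by an event \<open>B\<close> on the first \<open>n\<close>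
  coordinates and swap these with the next \<open>n\<close>. The swap fixes \<open>A\<close> and
  makes \<open>B\<close> independent of its image, so the measure of \<open>A\<close> is arbitrarily
  close to its own square.\<close>

theorem Hewitt_Savage_0_1_law:
  assumes A: "A \<in> sets S"
    and inv: "\<And>\<pi> n \<omega>. \<pi> permutes {..<n} \<Longrightarrow> \<omega> \<in> space S \<Longrightarrow> \<omega> \<circ> \<pi> \<in> A \<longleftrightarrow> \<omega> \<in> A"
  shows "measure S A \<in> {0, 1}"
proof -
  let ?p = "measure S A"
  \<comment> \<open>Replacing \<open>?p\<close> by the square of the measure of \<open>B\<close>
    costs at most \<open>2 * e\<close>, and so does returning to \<open>?p * ?p\<close>.\<close>
  have bound: "\<bar>?p - ?p * ?p\<bar> \<le> 4 * e" if e: "0 < e" for e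
  proof -
    obtain n B where B: "B \<in> sets S" "depends_on_first n B" "measure S ((A - B) \<union> (B - A)) < e"
      using approximable_sets[OF A] e unfolding approximable_def by blast
    define \<pi> where "\<pi> i = (if i < n then i + n else if i < 2 * n then i - n else i)" for i
    have invol: "\<pi> (\<pi> i) = i" for i by (auto simp: \<pi>_def)
    then have inj: "inj \<pi>" by (metis injI)
    have perm: "\<pi> permutes {..<2 * n}"
      unfolding permutes_def using invol by (metis \<pi>_def lessThan_iff trans_less_add1 mult_2)
    let ?T = "\<lambda>X. (\<lambda>\<omega>. \<omega> \<circ> \<pi>) -` X \<inter> space S"
    have T_sets: "?T B \<in> sets S" using measurable_sets[OF measurable_reindex B(1)] .
    have TA: "?T A = A" using inv[OF perm] sets.sets_into_space[OF A] by blast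
    have prod: "measure S (B \<inter> ?T B) = measure S B * measure S B"
      by (rule indep_first_shifted[OF B(1,2) _ inj]) (simp add: \<pi>_def)
    let ?D = "(A - B) \<union> (B - A)"
    have D: "?D \<in> sets S" using A B(1) by auto
    have TD: "?T ?D = (A - ?T B) \<union> (?T B - A)" using TA by blast
    have mTD: "measure S (?T ?D) < e" using measure_reindex[OF inj D] B(3) by simp
    have TD_sets: "?T ?D \<in> sets S" using measurable_sets[OF measurable_reindex D] .
    \<comment> \<open>A point of \<open>A\<close> outside both symmetric differences lies in
      \<open>B\<close> and in its image.\<close>
    have "?p \<le> measure S ((B \<inter> ?T B) \<union> (?D \<union> ?T ?D))"
      unfolding TD using A B(1) T_sets by (intro P.finite_measure_mono) auto
    also have "\<dots> \<le> measure S (B \<inter> ?T B) + measure S (?D \<union> ?T ?D)"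
      using B(1) T_sets D TD_sets by (intro measure_Un_le) auto
    also have "measure S (?D \<union> ?T ?D) \<le> measure S ?D + measure S (?T ?D)"
      using D TD_sets by (intro measure_Un_le)
    finally have 1: "?p \<le> measure S B * measure S B + 2 * e"
      using B(3) mTD prod by linarith
    have "measure S (B \<inter> ?T B) \<le> measure S (A \<union> ?D)"
      using A B(1) by (intro P.finite_measure_mono) auto
    also have "\<dots> \<le> ?p + measure S ?D"
      using A D by (intro measure_Un_le)
    finally have 2: "measure S B * measure S B \<le> ?p + e"
      using B(3) prod by linarith
    have "measure S B \<le> measure S (A \<union> ?D)" "?p \<le> measure S (B \<union> ?D)"
      using A B(1) by (auto intro!: P.finite_measure_mono)
    moreover have "measure S (A \<union> ?D) \<le> ?p + measure S ?D" "measure S (B \<union> ?D) \<le> measure S B + measure S ?D"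
      using A B(1) D by (auto intro!: measure_Un_le)
    ultimately have diff: "\<bar>measure S B - ?p\<bar> \<le> e" using B(3) by linarith
    have "measure S B * measure S B - ?p * ?p = (measure S B - ?p) * (measure S B + ?p)"
      by (simp add: algebra_simps)
    then have "\<bar>measure S B * measure S B - ?p * ?p\<bar> = \<bar>measure S B - ?p\<bar> * (measure S B + ?p)"
      by (simp add: abs_mult)
    also have "\<dots> \<le> e * 2"
      using diff e by (intro mult_mono) (auto intro: order_trans[OF add_mono[OF P.prob_le_1 P.prob_le_1]])
    finally show ?thesis using 1 2 e by linarith
  qed
  have "?p - ?p * ?p = 0"
  proof (rule ccontr)
    assume "?p - ?p * ?p \<noteq> 0"
    then show False using bound[of "\<bar>?p - ?p * ?p\<bar> / 8"] by simp
  qed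
  then have "?p * (1 - ?p) = 0" by (simp add: algebra_simps)
  then show ?thesis by auto
qed

end

subsection \<open>Random walks\<close>

lemma group_gen_subset: "A \<subseteq> group_gen B \<Longrightarrow> group_gen A \<subseteq> group_gen B"
proof
  fix x assume AB: "A \<subseteq> group_gen B" and "x \<in> group_gen A"
  from this(2) show "x \<in> group_gen B"
    by induction (use AB in \<open>auto intro: group_gen.intros\<close>)
qed

lemma semigroup_gen_mono: "A \<subseteq> B \<Longrightarrow> semigroup_gen A \<subseteq> semigroup_gen B"
proof
  fix x assume AB: "A \<subseteq> B" and "x \<in> semigroup_gen A"
  from this(2) show "x \<in> semigroup_gen B"
    by induction (use AB in \<open>auto intro: semigroup_gen.intros\<close>)
qed

lemma subsemigroup_semigroup_gen: "subsemigroup (semigroup_gen A)"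
  by (auto simp: subsemigroup_def intro: sg_add)

lemma semigroup_gen_uminus_image:
  fixes A :: "'a :: ab_group_add set"
  shows "semigroup_gen (uminus ` A) = uminus ` semigroup_gen A"
proof -
  have *: "- x \<in> semigroup_gen (uminus ` A)" if "x \<in> semigroup_gen A" for x and A :: "'a set"
    using that
  proof induction
    case (sg_add x y)
    then show ?case using semigroup_gen.sg_add[of "- x" "uminus ` A" "- y"] by simp
  qed (auto intro: sg_base)
  show ?thesis
  proof (intro equalityI subsetI)
    fix x assume "x \<in> semigroup_gen (uminus ` A)"
    from *[OF this] have "- x \<in> semigroup_gen A" by (simp add: image_image)
    then show "x \<in> uminus ` semigroup_gen A" by force
  qed (use * in auto)
qed

text \<open>Elements are indexed by nonempty words. Over a countable index set there are countably
  many of them, which later yields measurability.\<close>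

lemma semigroup_gen_image:
  fixes f :: "'i \<Rightarrow> 'a :: comm_monoid_add"
  shows "semigroup_gen (f ` I) = {sum_list (map f xs) | xs. xs \<noteq> [] \<and> set xs \<subseteq> I}"
proof (intro equalityI subsetI)
  fix x assume "x \<in> semigroup_gen (f ` I)"
  then show "x \<in> {sum_list (map f xs) | xs. xs \<noteq> [] \<and> set xs \<subseteq> I}"
  proof induction
    case (sg_base x)
    then obtain i where "i \<in> I" "x = f i" by blast
    then show ?case by (intro CollectI exI[of _ "[i]"]) auto
  next
    case (sg_add x y)
    then obtain xs ys where "x = sum_list (map f xs)" "xs \<noteq> []" "set xs \<subseteq> I"
      "y = sum_list (map f ys)" "set ys \<subseteq> I" by blast
    then show ?case by (intro CollectI exI[of _ "xs @ ys"]) auto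
  qed
next
  fix x assume "x \<in> {sum_list (map f xs) | xs. xs \<noteq> [] \<and> set xs \<subseteq> I}"
  then obtain xs where "x = sum_list (map f xs)" "xs \<noteq> []" "set xs \<subseteq> I" by blast
  then show "x \<in> semigroup_gen (f ` I)"
  proof (induction xs arbitrary: x)
    case (Cons i xs)
    then show ?case by (cases "xs = []") (auto intro: sg_add sg_base)
  qed simp
qed

text \<open>Increments are numbered from 0, so that the position at time \<open>m\<close> uses
  exactly the indices in \<open>{..<m}\<close> and fits permutations of initial segments.\<close>

definition walk_semigroup :: "nat \<Rightarrow> (nat \<Rightarrow> 'a :: comm_monoid_add) \<Rightarrow> 'a set" where
  "walk_semigroup n \<omega> = semigroup_gen ((\<lambda>m. \<Sum>i<m. \<omega> i) ` {n..})"

lemma walk_semigroup_antimono: "m \<le> n \<Longrightarrow> walk_semigroup n \<omega> \<subseteq> walk_semigroup m \<omega>"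
  unfolding walk_semigroup_def by (intro semigroup_gen_mono image_mono) auto

lemma walk_semigroup_uminus:
  fixes \<omega> :: "nat \<Rightarrow> 'a :: ab_group_add"
  shows "walk_semigroup n (uminus \<circ> \<omega>) = uminus ` walk_semigroup n \<omega>"
  by (simp add: walk_semigroup_def sum_negf image_image flip: semigroup_gen_uminus_image)

text \<open>From time \<open>N\<close> on, every position contains all the permuted increments, and
  addition is commutative.\<close>

lemma walk_semigroup_permute:
  assumes "\<pi> permutes {..<N}" "N \<le> n"
  shows "walk_semigroup n (\<omega> \<circ> \<pi>) = walk_semigroup n \<omega>"
proof -
  have "(\<Sum>i<m. (\<omega> \<circ> \<pi>) i) = (\<Sum>i<m. \<omega> i)" if "n \<le> m" for m
  proof -
    have "\<pi> permutes {..<m}"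
      using assms that by (intro permutes_subset[OF assms(1)]) auto
    from sum.permute[OF this, of \<omega>] show ?thesis by simp
  qed
  then show ?thesis
    unfolding walk_semigroup_def by (intro arg_cong[of _ _ semigroup_gen] image_cong) auto
qed

text \<open>An increment is the difference of two consecutive positions, both at times at least
  \<open>n\<close>.\<close>

lemma group_gen_walk_semigroup:
  fixes \<omega> :: "nat \<Rightarrow> 'a :: ab_group_add"
  assumes "n \<le> i"
  shows "\<omega> i \<in> group_gen (walk_semigroup n \<omega>)"
proof -
  have "(\<Sum>i<m. \<omega> i) \<in> group_gen (walk_semigroup n \<omega>)" if "n \<le> m" for m
    unfolding walk_semigroup_def using that by (auto intro!: gg_base sg_base)
  from gg_add[OF this[of "Suc i"] gg_neg[OF this[of i]]] assms show ?thesis by simp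
qed

lemma measurable_walk_semigroup:
  fixes \<mu> :: "'a :: {ab_group_add, countable} pmf"
  shows "walk_semigroup n \<in> (\<Pi>\<^sub>M i\<in>UNIV. measure_pmf \<mu>) \<rightarrow>\<^sub>M subsets_measure"
proof (rule measurable_subsets_measureI)
  fix g :: 'a
  let ?S = "\<Pi>\<^sub>M i\<in>(UNIV :: nat set). measure_pmf \<mu>"
  have coord: "(\<lambda>\<omega>. \<omega> i) \<in> ?S \<rightarrow>\<^sub>M count_space UNIV" for i
    using measurable_component_singleton[of i UNIV "\<lambda>_. measure_pmf \<mu>"]
    by (simp cong: measurable_cong_sets)
  \<comment> \<open>Countability of the group lets addition be handled one value of \<open>f\<close>
    at a time.\<close>
  have add: "(\<lambda>\<omega>. f \<omega> + h \<omega>) \<in> ?S \<rightarrow>\<^sub>M count_space UNIV"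
    if "f \<in> ?S \<rightarrow>\<^sub>M count_space UNIV" "h \<in> ?S \<rightarrow>\<^sub>M count_space UNIV" for f h :: "_ \<Rightarrow> 'a"
  proof (rule measurable_compose_countable[OF _ that(1), of "\<lambda>x \<omega>. x + h \<omega>"])
    show "(\<lambda>\<omega>. x + h \<omega>) \<in> ?S \<rightarrow>\<^sub>M count_space UNIV" for x
      by (rule measurable_compose[OF that(2)]) simp
  qed
  have pos: "(\<lambda>\<omega>. \<Sum>i<m. \<omega> i) \<in> ?S \<rightarrow>\<^sub>M count_space UNIV" for m
    by (induction m) (auto intro: add coord)
  have sums: "(\<lambda>\<omega>. sum_list (map (\<lambda>m. \<Sum>i<m. \<omega> i) xs)) \<in> ?S \<rightarrow>\<^sub>M count_space UNIV" for xs
    by (induction xs) (auto intro: add pos)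
  have "{\<omega> \<in> space ?S. g \<in> walk_semigroup n \<omega>} =
      (\<Union>xs\<in>{xs. xs \<noteq> [] \<and> set xs \<subseteq> {n..}}.
        (\<lambda>\<omega>. sum_list (map (\<lambda>m. \<Sum>i<m. \<omega> i) xs)) -` {g} \<inter> space ?S)"
    by (auto simp: walk_semigroup_def semigroup_gen_image)
  also have "\<dots> \<in> sets ?S"
    by (intro sets.countable_UN'' measurable_sets[OF sums]) auto
  finally show "{\<omega> \<in> space ?S. g \<in> walk_semigroup n \<omega>} \<in> sets ?S" .
qed

lemma AE_walk_semigroup_eq_UNIV:
  fixes \<mu> :: "(int ^ 'd) pmf"
  assumes sym: "symmetric_pmf \<mu>" and gen: "group_gen (set_pmf \<mu>) = UNIV"
  shows "AE \<omega> in (\<Pi>\<^sub>M i\<in>UNIV. measure_pmf \<mu>). \<forall>n. walk_semigroup n \<omega> = UNIV"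
proof -
  interpret sequence_space "measure_pmf \<mu>" by unfold_locales
  have space_S: "space S = UNIV" by (simp add: space_PiM)
  show ?thesis
  proof (rule P.AE_subsemigroups_eq_UNIV)
    show "walk_semigroup n \<in> S \<rightarrow>\<^sub>M subsets_measure" for n
      by (rule measurable_walk_semigroup)
    show "subsemigroup (walk_semigroup n \<omega>)" for n and \<omega> :: "nat \<Rightarrow> int ^ 'd"
      unfolding walk_semigroup_def by (rule subsemigroup_semigroup_gen)
    show "walk_semigroup (Suc n) \<omega> \<subseteq> walk_semigroup n \<omega>" for n and \<omega> :: "nat \<Rightarrow> int ^ 'd"
      by (rule walk_semigroup_antimono) simp
  next
    \<comment> \<open>Each support element is an increment at arbitrarily late times, so every walk
      semigroup generates the whole group.\<close>
    have "AE \<omega> in S. \<forall>g\<in>set_pmf \<mu>. \<forall>n. \<exists>i\<ge>n. \<omega> i = g"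
      unfolding AE_ball_countable[OF countable_set_pmf] AE_all_countable
      by (intro ballI allI AE_recurrent_value) (auto simp: measure_pmf_single pmf_positive)
    then show "AE \<omega> in S. \<forall>n. group_gen (walk_semigroup n \<omega>) = UNIV"
    proof eventually_elim
      case (elim \<omega>)
      have "set_pmf \<mu> \<subseteq> group_gen (walk_semigroup n \<omega>)" for n
        using elim group_gen_walk_semigroup[of n _ \<omega>] by (metis subsetI)
      from group_gen_subset[OF this] show ?case using gen by blast
    qed
  next
    fix K :: "(real ^ 'd) set" assume K: "compact K"
    let ?A = "{\<omega> \<in> space S. \<exists>n. dual_cone (walk_semigroup n \<omega>) \<inter> K \<noteq> {}}"
    show "measure S ?A \<in> {0, 1}"
    proof (rule Hewitt_Savage_0_1_law)
      have "?A = (\<Union>n. walk_semigroup n -` {A. dual_cone A \<inter> K \<noteq> {}} \<inter> space S)" by auto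
      also have "\<dots> \<in> sets S"
        by (rule sets.countable_UN) (use measurable_sets[OF measurable_walk_semigroup
          sets_dual_cone_meets_compact[OF K]] in blast)
      finally show "?A \<in> sets S" .
    next
      fix \<pi> :: "nat \<Rightarrow> nat" and N and \<omega> :: "nat \<Rightarrow> int ^ 'd"
      assume \<pi>: "\<pi> permutes {..<N}"
      \<comment> \<open>Since the cones increase, it is enough to look at times from
        \<open>N\<close> on, where permuting the first \<open>N\<close> increments has no
        effect.\<close>
      have late: "(\<exists>n. dual_cone (walk_semigroup n \<omega>) \<inter> K \<noteq> {}) \<longleftrightarrow>
          (\<exists>n\<ge>N. dual_cone (walk_semigroup n \<omega>) \<inter> K \<noteq> {})" for \<omega> :: "nat \<Rightarrow> int ^ 'd"
      proof -
        have "dual_cone (walk_semigroup n \<omega>) \<subseteq> dual_cone (walk_semigroup (max n N) \<omega>)" for n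
          by (intro dual_cone_antimono walk_semigroup_antimono) simp
        then show ?thesis by (meson disjoint_iff max.cobounded2 subsetD)
      qed
      show "\<omega> \<circ> \<pi> \<in> ?A \<longleftrightarrow> \<omega> \<in> ?A"
        using walk_semigroup_permute[OF \<pi>, of _ \<omega>] by (simp add: late space_S cong: conj_cong)
    qed
  next
    fix n
    have "distr (measure_pmf \<mu>) (measure_pmf \<mu>) uminus = distr (measure_pmf \<mu>) (count_space UNIV) uminus"
      by (rule distr_cong) auto
    also have "\<dots> = measure_pmf (map_pmf uminus \<mu>)"
      by (simp add: map_pmf_rep_eq)
    also have "map_pmf uminus \<mu> = \<mu>"
    proof (rule pmf_eqI)
      fix x
      have "pmf (map_pmf uminus \<mu>) (- (- x)) = pmf \<mu> (- x)"
        by (rule pmf_map_inj') (simp add: inj_def)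
      then show "pmf (map_pmf uminus \<mu>) x = pmf \<mu> x"
        using sym by (simp add: symmetric_pmf_def)
    qed
    finally have S: "distr S S (\<lambda>\<omega>. uminus \<circ> \<omega>) = S"
      by (intro distr_comp_coordinates) auto
    have meas: "(\<lambda>\<omega>. uminus \<circ> \<omega>) \<in> S \<rightarrow>\<^sub>M S"
      unfolding comp_def by (rule measurable_PiM_single') (auto simp: space_PiM)
    \<comment> \<open>Negating all increments preserves \<open>S\<close> and negates the walk
      semigroup.\<close>
    have "distr S subsets_measure (walk_semigroup n)
        = distr (distr S S (\<lambda>\<omega>. uminus \<circ> \<omega>)) subsets_measure (walk_semigroup n)"
      by (simp add: S)
    also have "\<dots> = distr S subsets_measure (walk_semigroup n \<circ> (\<lambda>\<omega>. uminus \<circ> \<omega>))"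
      by (rule distr_distr[OF measurable_walk_semigroup meas])
    finally show "distr S subsets_measure (walk_semigroup n)
        = distr S subsets_measure (\<lambda>\<omega>. uminus ` walk_semigroup n \<omega>)"
      by (simp add: comp_def walk_semigroup_uminus[unfolded comp_def])
  qed
qed

text \<open>\<^const>\<open>rw_pos\<close> ignores the increment with index 0, whence the shift by \<^const>\<open>Suc\<close>.\<close>

lemma algebraically_recurrent_if_symmetric:
  fixes \<mu> :: "(int ^ 'd) pmf"
  assumes "symmetric_pmf \<mu>" "group_gen (set_pmf \<mu>) = UNIV"
  shows "algebraically_recurrent \<mu>"
  unfolding algebraically_recurrent_def
proof (intro allI impI)
  fix n
  interpret sequence_space "measure_pmf \<mu>" by unfold_locales
  have "AE \<omega> in distr S S (\<lambda>\<omega>. \<omega> \<circ> Suc). \<forall>n. walk_semigroup n \<omega> = UNIV"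
    using AE_walk_semigroup_eq_UNIV[OF assms] by (subst distr_reindex) auto
  from AE_distrD[OF measurable_reindex this]
  show "AE \<omega> in S. semigroup_gen {rw_pos \<omega> m | m. m \<ge> n} = UNIV"
  proof eventually_elim
    case (elim \<omega>)
    have "rw_pos \<omega> m = (\<Sum>i<m. (\<omega> \<circ> Suc) i)" for m
      by (simp add: rw_pos_def sum.atLeast1_atMost_eq)
    then have "walk_semigroup n (\<omega> \<circ> Suc) = semigroup_gen {rw_pos \<omega> m | m. m \<ge> n}"
      unfolding walk_semigroup_def by (intro arg_cong[of _ _ semigroup_gen]) auto
    with elim show ?case by simp
  qed
qed

theorem mainTheorem5:
  fixes M :: "'w measure"
    and H :: "nat \<Rightarrow> 'w \<Rightarrow> (int ^ 'd) set"
  shows "(\<forall>\<mu> :: (int ^ 'd) pmf. symmetric_pmf \<mu> \<and> group_gen (set_pmf \<mu>) = UNIV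
              \<longrightarrow> algebraically_recurrent \<mu>)
    \<and> ((prob_space M
        \<and> (\<forall>n. H n \<in> M \<rightarrow>\<^sub>M subsets_measure)
        \<and> (\<forall>n. \<forall>\<omega>\<in>space M. subsemigroup (H n \<omega>))
        \<and> (\<forall>n. \<forall>\<omega>\<in>space M. H (Suc n) \<omega> \<subseteq> H n \<omega>)
        \<and> (AE \<omega> in M. \<forall>n. group_gen (H n \<omega>) = UNIV)
        \<and> (\<forall>A\<in>prob_space.tail_events M
               (\<lambda>k. {H k -` B \<inter> space M | B. B \<in> sets subsets_measure}).
             measure M A = 0 \<or> measure M A = 1)
        \<and> (\<forall>n. distr M subsets_measure (H n)
               = distr M subsets_measure (\<lambda>\<omega>. uminus ` H n \<omega>)))
       \<longrightarrow> (AE \<omega> in M. \<forall>n. H n \<omega> = UNIV))"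
proof (intro conjI allI impI)
  fix \<mu> :: "(int ^ 'd) pmf"
  assume "symmetric_pmf \<mu> \<and> group_gen (set_pmf \<mu>) = UNIV"
  then show "algebraically_recurrent \<mu>"
    by (intro algebraically_recurrent_if_symmetric) auto
next
  assume *: "prob_space M
        \<and> (\<forall>n. H n \<in> M \<rightarrow>\<^sub>M subsets_measure)
        \<and> (\<forall>n. \<forall>\<omega>\<in>space M. subsemigroup (H n \<omega>))
        \<and> (\<forall>n. \<forall>\<omega>\<in>space M. H (Suc n) \<omega> \<subseteq> H n \<omega>)
        \<and> (AE \<omega> in M. \<forall>n. group_gen (H n \<omega>) = UNIV)
        \<and> (\<forall>A\<in>prob_space.tail_events M
               (\<lambda>k. {H k -` B \<inter> space M | B. B \<in> sets subsets_measure}).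
             measure M A = 0 \<or> measure M A = 1)
        \<and> (\<forall>n. distr M subsets_measure (H n)
               = distr M subsets_measure (\<lambda>\<omega>. uminus ` H n \<omega>))"
  then interpret prob_space M by blast
  show "AE \<omega> in M. \<forall>n. H n \<omega> = UNIV"
    by (rule AE_Liouville_subsemigroups_eq_UNIV) (use * in blast)+
qed

end
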